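(* Let $\mathfrak T_{\rm pr}\subseteq\mathfrak T$ be the ($G_\delta$) set of non-empty pruned normal trees, and let $\le^{\rm pr}_{\boldsymbol\Sigma^1_1},\equiv^{\rm pr}_{\boldsymbol\Sigma^1_1},\not\subseteq^{\rm pr}_{\boldsymbol\Sigma^1_1},\neq^{\rm pr}_{\boldsymbol\Sigma^1_1}$ be the restrictions to $\mathfrak T_{\rm pr}$ of the corresponding relations. Then (i) the pair $(\le^{\rm pr}_{\boldsymbol\Sigma^1_1},\not\subseteq^{\rm pr}_{\boldsymbol\Sigma^1_1})$ is complete for the class $\mathcal C_{\rm qo}$ of analytic quasiorders, and (ii) the pair $(\equiv^{\rm pr}_{\boldsymbol\Sigma^1_1},\neq^{\rm pr}_{\boldsymbol\Sigma^1_1})$ is complete for the class $\mathcal C_{\rm eq}$ of analytic equivalence relations.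
   Context: For finite sequences $s,t\in\omega^{<\omega}$, $s\le t$ means $|s|=|t|$ and $s(i)\le t(i)$ for all $i$; $(s+t)(i)=s(i)+t(i)$. A normal tree on $2\times\omega$ is a set $T$ of pairs $(u,s)\in 2^{<\omega}\times\omega^{<\omega}$ with $|u|=|s|$, containing $(\emptyset,\emptyset)$, closed under initial segments, and such that $(u,s)\in T$, $s\le t$ imply $(u,t)\in T$; $\mathfrak T$ is the space of normal trees (closed in $2^{(2\times\omega)^{<\omega}}$). A tree is pruned if every element has a proper extension in it. $A(T)=\{\alpha\in 2^\omega:\exists\beta\in\omega^\omega\,\forall n\,(\alpha|_n,\beta|_n)\in T\}$. $S\le_{\boldsymbol\Sigma^1_1}T$ iff $\exists\alpha\in\omega^\omega\,\forall(u,s)\in S\,(u,s+\alpha|_{|s|})\in T$; $S\equiv_{\boldsymbol\Sigma^1_1}T$ iff both $S\le_{\boldsymbol\Sigma^1_1} T$ and $T\le_{\boldsymbol\Sigma^1_1} S$; $S\not\subseteq_{\boldsymbol\Sigma^1_1}T$ iff $A(S)\not\subseteq A(T)$; $S\neq_{\boldsymbol\Sigma^1_1}T$ iff $A(S)\neq A(T)$. A Borel homomorphism from a pair $(R_1,R_2)$ of relations on standard Borel $X$ to a pair $(S_1,S_2)$ on $Y$ is a Borel $f:X\to Y$ with $xR_iy\Rightarrow f(x)S_if(y)$ for $i=1,2$. A pair $(R_1,R_2)$ is complete for a class $\mathcal C$ of relations if every $R\in\mathcal C$ admits a Borel homomorphism from $(R,\neg R)$ to $(R_1,R_2)$, and some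 $R\in\mathcal C$ admits a Borel homomorphism from $(R_1,R_2)$ to $(R,\neg R)$. *)

theory Defs
  imports "HOL-Analysis.Analysis"
begin

definition Polish_space :: "'a topology \<Rightarrow> bool" where
  "Polish_space X \<longleftrightarrow> completely_metrizable_space X \<and> separable_space X"

definition standard_borel :: "'a measure \<Rightarrow> bool" where
  "standard_borel M \<longleftrightarrow> (\<exists>X. Polish_space X \<and> space M = topspace X \<and>
       sets M = sigma_sets (topspace X) {U. openin X U})"

definition analytic_set :: "'a measure \<Rightarrow> 'a set \<Rightarrow> bool" where
  "analytic_set M A \<longleftrightarrow> A = {} \<or>
     (\<exists>f. f \<in> (borel :: (nat \<Rightarrow> nat) measure) \<rightarrow>\<^sub>M M \<and> f ` UNIV = A)"

definition analytic_quasiorder :: "'a measure \<Rightarrow> ('a \<times> 'a) set \<Rightarrow> bool" where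
  "analytic_quasiorder M R \<longleftrightarrow> R \<subseteq> space M \<times> space M \<and> preorder_on (space M) R
     \<and> analytic_set (M \<Otimes>\<^sub>M M) R"

definition analytic_equivalence :: "'a measure \<Rightarrow> ('a \<times> 'a) set \<Rightarrow> bool" where
  "analytic_equivalence M R \<longleftrightarrow> equiv (space M) R \<and> analytic_set (M \<Otimes>\<^sub>M M) R"

text \<open>A tree on 2 x omega is represented by its characteristic function on pairs
  (u,s) of finite sequences; the space of all such is the product space
  2^((2 x omega)^{<omega}) (up to the canonical identification of pairs of equal
  length sequences with sequences of pairs).\<close>
type_synonym tree = "bool list \<times> nat list \<Rightarrow> bool"

definition seq_le :: "nat list \<Rightarrow> nat list \<Rightarrow> bool" where
  "seq_le s t \<longleftrightarrow> length s = length t \<and> (\<forall>i<length s. s ! i \<le> t ! i)"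

definition normal_tree :: "tree \<Rightarrow> bool" where
  "normal_tree T \<longleftrightarrow>
     (\<forall>u s. T (u, s) \<longrightarrow> length u = length s) \<and>
     T ([], []) \<and>
     (\<forall>u s n. T (u, s) \<longrightarrow> T (take n u, take n s)) \<and>
     (\<forall>u s t. T (u, s) \<and> seq_le s t \<longrightarrow> T (u, t))"

definition pruned :: "tree \<Rightarrow> bool" where
  "pruned T \<longleftrightarrow> (\<forall>u s. T (u, s) \<longrightarrow>
      (\<exists>v w. v \<noteq> [] \<and> w \<noteq> [] \<and> T (u @ v, s @ w)))"

definition Tpr :: "tree set" where
  "Tpr = {T. normal_tree T \<and> T ([], []) \<and> pruned T}"

definition restr :: "(nat \<Rightarrow> 'a) \<Rightarrow> nat \<Rightarrow> 'a list" where
  "restr \<alpha> n = map \<alpha> [0..<n]"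

definition A_tree :: "tree \<Rightarrow> (nat \<Rightarrow> bool) set" where
  "A_tree T = {\<alpha>. \<exists>\<beta>::nat \<Rightarrow> nat. \<forall>n. T (restr \<alpha> n, restr \<beta> n)}"

definition seq_add :: "nat list \<Rightarrow> nat list \<Rightarrow> nat list" where
  "seq_add s t = map (\<lambda>i. s ! i + t ! i) [0..<length s]"

definition le_S :: "tree \<Rightarrow> tree \<Rightarrow> bool" where
  "le_S S T \<longleftrightarrow> (\<exists>\<alpha>::nat \<Rightarrow> nat. \<forall>u s. S (u, s) \<longrightarrow> T (u, seq_add s (restr \<alpha> (length s))))"

definition eq_S :: "tree \<Rightarrow> tree \<Rightarrow> bool" where
  "eq_S S T \<longleftrightarrow> le_S S T \<and> le_S T S"

definition nsub_S :: "tree \<Rightarrow> tree \<Rightarrow> bool" where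
  "nsub_S S T \<longleftrightarrow> \<not> (A_tree S \<subseteq> A_tree T)"

definition neq_S :: "tree \<Rightarrow> tree \<Rightarrow> bool" where
  "neq_S S T \<longleftrightarrow> A_tree S \<noteq> A_tree T"

definition Tpr_space :: "tree measure" where
  "Tpr_space = restrict_space borel Tpr"

definition borel_hom ::
  "'a measure \<Rightarrow> ('a \<Rightarrow> 'a \<Rightarrow> bool) \<Rightarrow> ('a \<Rightarrow> 'a \<Rightarrow> bool) \<Rightarrow>
   'b measure \<Rightarrow> ('b \<Rightarrow> 'b \<Rightarrow> bool) \<Rightarrow> ('b \<Rightarrow> 'b \<Rightarrow> bool) \<Rightarrow> ('a \<Rightarrow> 'b) \<Rightarrow> bool" where
  "borel_hom M R1 R2 N S1 S2 f \<longleftrightarrow> f \<in> M \<rightarrow>\<^sub>M N \<and>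
     (\<forall>x\<in>space M. \<forall>y\<in>space M. (R1 x y \<longrightarrow> S1 (f x) (f y)) \<and> (R2 x y \<longrightarrow> S2 (f x) (f y)))"

end

theory Submission
  imports Defs
begin

text \<open>
  An analytic quasiorder \<open>R\<close> is moved to \<open>2\<^sup>\<omega>\<close> by recording membership in a separating sequence of
  Borel sets, where it becomes the projection of a closed set \<open>F\<close>. Call \<open>(u, v, s)\<close> a chain node if \<open>u\<close>
  and \<open>v\<close> are joined by a chain of \<open>s(0)\<close> nodes of the tree of \<open>F\<close> whose witnesses sum up to at most
  \<open>s\<close>. Concatenating chains adds the third components, so the fibres
  \<open>{(u, s). (u, x|n, s) is a chain node}\<close> are \<open>\<le>\<close>-related whenever \<open>x R y\<close>. Conversely, the length of the
  chains along a branch over \<open>(a, b)\<close> is bounded by its first entry and their witnesses by the branch itself, so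
  compactness yields points \<open>a = x\<^sub>0 R x\<^sub>1 R \<dots> R x\<^sub>k = b\<close>, and the fibre at \<open>y\<close> projects to \<open>{x. x R y}\<close>.
  Pruning lets every branch continue by zeros; this adds only eventually zero sequences,
  which the coding avoids.

  For the other half, both relations are already defined on the compact space of all subsets of
  \<open>2\<^sup><\<^sup>\<omega> \<times> \<omega>\<^sup><\<^sup>\<omega>\<close>, which is transported to the reals by an arbitrary injection.
\<close>

section \<open>Suslin sets\<close>

instance bool :: second_countable_topology
proof
  have "open = generate_topology (UNIV :: bool set set)"
    by (auto simp: fun_eq_iff open_discrete intro: generate_topology.Basis)
  then show "\<exists>B :: bool set set. countable B \<and> open = generate_topology B"
    by (metis countable_finite finite)
qed

lemma euclidean_eq_discrete_topology:
  "(euclidean :: 'a::discrete_topology topology) = discrete_topology UNIV"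
  by (simp add: topology_eq open_discrete)

lemma tendsto_fun_iff:
  fixes f :: "'c \<Rightarrow> 'i \<Rightarrow> 'b::topological_space"
  shows "(f \<longlongrightarrow> l) F \<longleftrightarrow> (\<forall>i. ((\<lambda>c. f c i) \<longlongrightarrow> l i) F)"
  using limitin_componentwise[of "\<lambda>i. euclidean" UNIV f l F]
  by (simp add: euclidean_product_topology)

text \<open>Analyticity as projection of a closed set. Unlike a Borel parametrization, this form
  supplies a closed set of witnesses, to which compactness can be applied.\<close>

definition suslin :: "'b::topological_space set \<Rightarrow> bool" where
  "suslin A \<longleftrightarrow> (\<exists>F :: ('b \<times> (nat \<Rightarrow> nat)) set. closed F \<and> A = fst ` F)"

section \<open>Closure properties of Suslin sets\<close>

lemma suslin_closed: "closed A \<Longrightarrow> suslin A"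
  unfolding suslin_def by (intro exI[of _ "A \<times> UNIV"]) (auto simp: closed_Times)

lemma suslin_vimage:
  assumes f: "continuous_on UNIV f" and A: "suslin A"
  shows "suslin (f -` A)"
proof -
  obtain F :: "('b \<times> (nat \<Rightarrow> nat)) set" where F: "closed F" "A = fst ` F"
    using A unfolding suslin_def by blast
  have "closed ((\<lambda>p. (f (fst p), snd p)) -` F)"
    by (intro closed_vimage F continuous_intros continuous_on_compose2[OF f]) auto
  moreover have "f -` A = fst ` ((\<lambda>p. (f (fst p), snd p)) -` F)"
  proof safe
    fix x assume "f x \<in> A"
    then obtain w where "(f x, w) \<in> F" by (auto simp: F)
    then show "x \<in> fst ` ((\<lambda>p. (f (fst p), snd p)) -` F)"
      by (intro image_eqI[of _ _ "(x, w)"]) auto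
  qed (force simp: F)
  ultimately show ?thesis unfolding suslin_def by blast
qed

text \<open>Several witnesses are packed into one sequence below. Unpacking only reindexes, so
  preimages of closed sets under it are closed.\<close>

lemma continuous_on_reindex: "continuous_on UNIV (\<lambda>p. \<lambda>k::nat. (snd p :: nat \<Rightarrow> nat) (e k))"
  by (rule continuous_on_coordinatewise_then_product)
     (rule continuous_on_product_then_coordinatewise[OF continuous_on_snd[OF continuous_on_id]])

text \<open>The first entry of a witness names a member of the union, and the tail witnesses
  membership in it.\<close>

lemma suslin_UN:
  fixes A :: "nat \<Rightarrow> 'b::topological_space set"
  assumes A: "\<And>n. suslin (A n)"
  shows "suslin (\<Union>n. A n)"
proof -
  obtain F :: "nat \<Rightarrow> ('b \<times> (nat \<Rightarrow> nat)) set" where F: "\<And>n. closed (F n)" "\<And>n. A n = fst ` F n"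
    using A unfolding suslin_def by metis
  \<comment> \<open>An implication for every \<open>n\<close> rather than a union over
    \<open>n\<close>, so that \<open>G\<close> is visibly an intersection of closed sets; the
    condition on the first entry is clopen.\<close>
  define G where "G = (\<Inter>n. (\<lambda>p :: 'b \<times> (nat \<Rightarrow> nat). snd p 0) -` (- {n}) \<union>
    (\<lambda>p. (fst p, \<lambda>k. snd p (Suc k))) -` F n)"
  have "continuous_on UNIV (\<lambda>p::'b \<times> (nat \<Rightarrow> nat). snd p 0)"
    by (rule continuous_on_product_then_coordinatewise[OF continuous_on_snd[OF continuous_on_id]])
  then have "closed ((\<lambda>p::'b \<times> (nat \<Rightarrow> nat). snd p 0) -` (- {n}))" for n
    by (rule closed_vimage[rotated]) (simp add: closed_def open_discrete)
  moreover have "closed ((\<lambda>p::'b \<times> (nat \<Rightarrow> nat). (fst p, \<lambda>k. snd p (Suc k))) -` F n)" for n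
    by (intro closed_vimage F continuous_on_Pair continuous_on_fst continuous_on_id
        continuous_on_reindex)
  ultimately have "closed G" unfolding G_def by (intro closed_INT ballI closed_Un)
  moreover have "(\<Union>n. A n) = fst ` G"
  proof safe
    fix x n assume "x \<in> A n"
    then obtain w where "(x, w) \<in> F n" by (auto simp: F)
    then have "(x, case_nat n w) \<in> G" by (auto simp: G_def)
    then show "x \<in> fst ` G" by (intro image_eqI[of _ _ "(x, case_nat n w)"]) auto
  next
    fix x w assume "(x, w) \<in> G"
    then have "(x, \<lambda>k. w (Suc k)) \<in> F (w 0)" by (auto simp: G_def)
    then show "fst (x, w) \<in> (\<Union>n. A n)" by (force simp: F)
  qed
  ultimately show ?thesis unfolding suslin_def by blast
qed

text \<open>Column \<open>n\<close> of the witness, read along \<open>prod_encode\<close>, witnesses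
  membership in the \<open>n\<close>-th set.\<close>

lemma suslin_INT:
  fixes A :: "nat \<Rightarrow> 'b::topological_space set"
  assumes A: "\<And>n. suslin (A n)"
  shows "suslin (\<Inter>n. A n)"
proof -
  obtain F :: "nat \<Rightarrow> ('b \<times> (nat \<Rightarrow> nat)) set" where F: "\<And>n. closed (F n)" "\<And>n. A n = fst ` F n"
    using A unfolding suslin_def by metis
  define G where "G = (\<Inter>n. (\<lambda>p. (fst p, \<lambda>k. snd p (prod_encode (n, k)))) -` F n)"
  have "closed G" unfolding G_def
    by (intro closed_INT ballI closed_vimage F continuous_on_Pair continuous_on_fst continuous_on_id
        continuous_on_reindex)
  moreover have "(\<Inter>n. A n) = fst ` G"
  proof safe
    fix x assume "x \<in> (\<Inter>n. A n)"
    then have "\<forall>n. \<exists>w. (x, w) \<in> F n" by (force simp: F)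
    then obtain w where w: "\<And>n. (x, w n) \<in> F n" by metis
    have "(x, \<lambda>m. case prod_decode m of (n, k) \<Rightarrow> w n k) \<in> G"
      using w by (auto simp: G_def)
    then show "x \<in> fst ` G" by force
  next
    fix x w n assume "(x, w) \<in> G"
    then have "(x, \<lambda>k. w (prod_encode (n, k))) \<in> F n" by (auto simp: G_def)
    then show "fst (x, w) \<in> A n" by (force simp: F)
  qed
  ultimately show ?thesis unfolding suslin_def by blast
qed

lemma suslin_Un: "suslin A \<Longrightarrow> suslin B \<Longrightarrow> suslin (A \<union> B)"
proof -
  have "(\<Union>n::nat. if n = 0 then A else B) = A \<union> B" by (auto split: if_splits)
  then show "suslin A \<Longrightarrow> suslin B \<Longrightarrow> suslin (A \<union> B)"
    using suslin_UN[of "\<lambda>n. if n = 0 then A else B"] by auto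
qed

lemma suslin_Int: "suslin A \<Longrightarrow> suslin B \<Longrightarrow> suslin (A \<inter> B)"
proof -
  have "(\<Inter>n::nat. if n = 0 then A else B) = A \<inter> B" by (auto split: if_splits)
  then show "suslin A \<Longrightarrow> suslin B \<Longrightarrow> suslin (A \<inter> B)"
    using suslin_INT[of "\<lambda>n. if n = 0 then A else B"] by auto
qed

text \<open>The projected coordinate and the old witness become the even and odd entries of one
  witness.\<close>

lemma suslin_projection:
  fixes A :: "('b::topological_space \<times> (nat \<Rightarrow> nat)) set"
  assumes "suslin A"
  shows "suslin (fst ` A)"
proof -
  obtain F :: "(('b \<times> (nat \<Rightarrow> nat)) \<times> (nat \<Rightarrow> nat)) set" where F: "closed F" "A = fst ` F"
    using assms unfolding suslin_def by blast
  define G where "G = (\<lambda>p. ((fst p, \<lambda>k. snd p (2 * k)), \<lambda>k. snd p (2 * k + 1))) -` F"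
  have "closed G" unfolding G_def
    by (intro closed_vimage F continuous_on_Pair continuous_on_fst continuous_on_id
        continuous_on_reindex)
  moreover have "fst ` A = fst ` G"
  proof safe
    fix x z assume "(x, z) \<in> A"
    then obtain w where "((x, z), w) \<in> F" by (auto simp: F)
    then have "(x, \<lambda>k. if even k then z (k div 2) else w (k div 2)) \<in> G"
      by (auto simp: G_def)
    then show "fst (x, z) \<in> fst ` G" by force
  next
    fix x w assume "(x, w) \<in> G"
    then show "fst (x, w) \<in> fst ` A" by (force simp: G_def F)
  qed
  ultimately show ?thesis unfolding suslin_def by blast
qed

text \<open>The complement is carried through the induction because a Suslin set need not have a
  Suslin complement. Open sets are handled as F-sigma sets, by metrizability.\<close>

lemma suslin_Baire_borel:
  fixes A :: "(nat \<Rightarrow> nat) set"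
  assumes "A \<in> sets borel"
  shows "suslin A \<and> suslin (- A)"
proof -
  have "A \<in> sigma_sets UNIV {S. open S}"
    using assms by (simp add: sets_borel)
  then show ?thesis
  proof induction
    case (Basic S)
    have "metrizable_space (euclidean :: (nat \<Rightarrow> nat) topology)"
      unfolding euclidean_product_topology[symmetric]
      by (simp add: metrizable_space_product_topology euclidean_eq_discrete_topology)
    then have "fsigma_in euclidean S"
      using Basic by (intro open_imp_fsigma_in) auto
    then obtain C where "\<And>n. closed (C n)" "S = (\<Union>n::nat. C n)"
      unfolding fsigma_in_ascending by auto
    then have "suslin S" by (simp add: suslin_UN suslin_closed)
    moreover have "suslin (- S)" using Basic by (intro suslin_closed) auto
    ultimately show ?case ..
  next
    case Empty
    show ?case by (auto intro: suslin_closed)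
  next
    case (Compl S)
    then show ?case by (simp add: Compl_eq_Diff_UNIV[symmetric])
  next
    case (Union S)
    then show ?case by (auto simp: Compl_UN intro: suslin_UN suslin_INT)
  qed
qed

text \<open>Equality with \<open>h z\<close> says that for every \<open>n\<close> the two values are
  both true or both false, so Suslin forms of a Borel set and of its complement are used.\<close>

lemma suslin_graph:
  fixes h :: "(nat \<Rightarrow> nat) \<Rightarrow> nat \<Rightarrow> bool"
  assumes "\<And>n. {z. h z n} \<in> sets borel"
  shows "suslin {(a, z). a = h z}"
proof -
  have cont: "continuous_on UNIV (\<lambda>p::(nat \<Rightarrow> bool) \<times> (nat \<Rightarrow> nat). fst p n)" for n
    by (rule continuous_on_product_then_coordinatewise[OF continuous_on_fst[OF continuous_on_id]])
  have *: "suslin ((\<lambda>p::(nat \<Rightarrow> bool) \<times> (nat \<Rightarrow> nat). fst p n) -` S)" for S n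
    by (intro suslin_closed closed_vimage cont) (auto simp: closed_def open_discrete)
  have **: "suslin ((snd :: (nat \<Rightarrow> bool) \<times> (nat \<Rightarrow> nat) \<Rightarrow> _) -` {z. h z n})"
     "suslin ((snd :: (nat \<Rightarrow> bool) \<times> (nat \<Rightarrow> nat) \<Rightarrow> _) -` (- {z. h z n}))" for n
    using suslin_Baire_borel[OF assms[of n]]
    by (blast intro: suslin_vimage[OF continuous_on_snd[OF continuous_on_id]])+
  have "{(a, z). a = h z} =
    (\<Inter>n. (\<lambda>p. fst p n) -` {True} \<inter> snd -` {z. h z n} \<union>
      (\<lambda>p. fst p n) -` {False} \<inter> snd -` (- {z. h z n}))" (is "_ = ?I")
  proof (rule set_eqI)
    fix p :: "(nat \<Rightarrow> bool) \<times> (nat \<Rightarrow> nat)"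
    have "p \<in> ?I \<longleftrightarrow> (\<forall>n. fst p n = h (snd p) n)" by auto
    then show "p \<in> {(a, z). a = h z} \<longleftrightarrow> p \<in> ?I"
      by (cases p) (simp add: fun_eq_iff)
  qed
  moreover have "suslin ?I"
    by (intro suslin_INT suslin_Un suslin_Int * **)
  ultimately show ?thesis by (simp only:)
qed

text \<open>The range is the projection along \<open>z\<close> of the intersection of two
  graphs.\<close>

lemma suslin_range_Pair:
  fixes h k :: "(nat \<Rightarrow> nat) \<Rightarrow> nat \<Rightarrow> bool"
  assumes h: "\<And>n. {z. h z n} \<in> sets borel" and k: "\<And>n. {z. k z n} \<in> sets borel"
  shows "suslin (range (\<lambda>z. (h z, k z)))"
proof -
  define H :: "(((nat \<Rightarrow> bool) \<times> (nat \<Rightarrow> bool)) \<times> (nat \<Rightarrow> nat)) set"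
    where "H = (\<lambda>p. (fst (fst p), snd p)) -` {(a, z). a = h z}"
  define K :: "(((nat \<Rightarrow> bool) \<times> (nat \<Rightarrow> bool)) \<times> (nat \<Rightarrow> nat)) set"
    where "K = (\<lambda>p. (snd (fst p), snd p)) -` {(a, z). a = k z}"
  have "suslin H"
    unfolding H_def by (rule suslin_vimage[OF _ suslin_graph[OF h]])
      (intro continuous_on_Pair continuous_on_fst continuous_on_snd continuous_on_id)
  moreover have "suslin K"
    unfolding K_def by (rule suslin_vimage[OF _ suslin_graph[OF k]])
      (intro continuous_on_Pair continuous_on_fst continuous_on_snd continuous_on_id)
  ultimately have "suslin (fst ` (H \<inter> K))"
    by (intro suslin_projection suslin_Int)
  moreover have "range (\<lambda>z. (h z, k z)) = fst ` (H \<inter> K)"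
  proof (intro equalityI subsetI)
    fix x assume "x \<in> range (\<lambda>z. (h z, k z))"
    then obtain z where "x = (h z, k z)" by blast
    then show "x \<in> fst ` (H \<inter> K)"
      by (intro image_eqI[of _ _ "(x, z)"]) (auto simp: H_def K_def)
  next
    fix x assume "x \<in> fst ` (H \<inter> K)"
    then obtain z where "(x, z) \<in> H" "(x, z) \<in> K" by auto
    then show "x \<in> range (\<lambda>z. (h z, k z))"
      by (intro image_eqI[of _ _ z]) (auto simp: H_def K_def prod_eq_iff)
  qed
  ultimately show ?thesis by (simp only:)
qed

section \<open>Chains of nodes\<close>

lemma length_restr [simp]: "length (restr a n) = n"
  by (simp add: restr_def)

lemma nth_restr [simp]: "i < n \<Longrightarrow> restr a n ! i = a i"
  by (simp add: restr_def)

lemma take_restr: "take m (restr a n) = restr a (min m n)"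
  by (rule nth_equalityI) auto

lemma restr_eq_iff: "restr a n = restr b n \<longleftrightarrow> (\<forall>i<n. a i = b i)"
  by (auto simp: list_eq_iff_nth_eq)

lemma restr_nth [simp]: "restr ((!) u) (length u) = u"
  by (rule nth_equalityI) auto

lemma length_seq_add [simp]: "length (seq_add s t) = length s"
  by (simp add: seq_add_def)

lemma nth_seq_add [simp]: "i < length s \<Longrightarrow> seq_add s t ! i = s ! i + t ! i"
  by (simp add: seq_add_def)

lemma seq_add_restr_0: "seq_add s (restr (\<lambda>_. 0) (length s)) = s"
  by (rule nth_equalityI) auto

lemma seq_add_restr_assoc:
  "seq_add (seq_add s (restr \<alpha> (length s))) (restr \<beta> (length s)) = seq_add s (restr (\<lambda>i. \<alpha> i + \<beta> i) (length s))"
  by (rule nth_equalityI) auto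

text \<open>At a fixed coordinate \<open>j\<close> both sequences agree as soon as
  \<open>r m > j\<close>, so they share their pointwise limit along \<open>r\<close>.\<close>

lemma tendsto_if_restr_eq:
  fixes p q :: "nat \<Rightarrow> nat \<Rightarrow> 'b::topological_space"
  assumes eq: "\<And>n. restr (p n) n = restr (q n) n" and r: "strict_mono r"
    and lim: "(\<lambda>m. q (r m)) \<longlonglongrightarrow> l"
  shows "(\<lambda>m. p (r m)) \<longlonglongrightarrow> l"
  unfolding tendsto_fun_iff
proof
  fix j
  have "eventually (\<lambda>m. q (r m) j = p (r m) j) sequentially"
    unfolding eventually_sequentially
  proof (intro exI allI impI)
    fix m assume "Suc j \<le> m"
    then have "j < r m" using seq_suble[OF r, of m] by linarith
    then show "q (r m) j = p (r m) j" using eq[of "r m"] by (simp add: restr_eq_iff)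
  qed
  moreover have "(\<lambda>m. q (r m) j) \<longlonglongrightarrow> l j" using lim by (simp add: tendsto_fun_iff)
  ultimately show "(\<lambda>m. p (r m) j) \<longlonglongrightarrow> l j" by (rule Lim_transform_eventually[rotated])
qed

text \<open>Tychonoff, applied to the finite sets \<open>{..b j}\<close> and then over the first
  index. It provides limits for the witnesses of chains.\<close>

lemma compact_bounded_functions:
  fixes b :: "'i \<Rightarrow> nat"
  shows "compact {f :: 'j \<Rightarrow> 'i \<Rightarrow> nat. \<forall>i j. f i j \<le> b j}"
proof -
  have *: "compact (Pi\<^sub>E UNIV S)" if "\<And>i. compact (S i)" for S :: "'k \<Rightarrow> 'c::topological_space set"
    using that compactin_PiE[of "\<lambda>i. euclidean" UNIV S]
    by (simp add: euclidean_product_topology)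
  have "compact (Pi\<^sub>E UNIV (\<lambda>i::'j. Pi\<^sub>E UNIV (\<lambda>j. {..b j})))"
    by (intro * finite_imp_compact) auto
  also have "Pi\<^sub>E UNIV (\<lambda>i::'j. Pi\<^sub>E UNIV (\<lambda>j. {..b j})) = {f. \<forall>i j. f i j \<le> b j}"
    by (auto simp: PiE_UNIV_domain)
  finally show ?thesis .
qed

lemma compact_UNIV_bool_functions: "compact (UNIV :: ('j \<Rightarrow> 'i \<Rightarrow> bool) set)"
proof -
  have *: "compact (UNIV :: ('k \<Rightarrow> 'c::topological_space) set)" if "compact (UNIV :: 'c set)"
    using that compactin_PiE[of "\<lambda>i. euclidean" UNIV "\<lambda>i::'k. UNIV :: 'c set"]
    by (simp add: euclidean_product_topology PiE_UNIV_domain)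
  show ?thesis
    by (intro * finite_imp_compact) auto
qed

section \<open>The tree of initial segments of \<open>F\<close> and chains of its nodes\<close>

definition node :: "(((nat \<Rightarrow> bool) \<times> (nat \<Rightarrow> bool)) \<times> (nat \<Rightarrow> nat)) set \<Rightarrow>
    bool list \<Rightarrow> bool list \<Rightarrow> nat list \<Rightarrow> bool" where
  "node F u v s \<longleftrightarrow> (\<exists>a b w n. ((a, b), w) \<in> F \<and> u = restr a n \<and> v = restr b n \<and> s = restr w n)"

lemma node_restrD:
  assumes "node F (restr x n) (restr y n) (restr t n)"
  shows "\<exists>a b w. ((a, b), w) \<in> F \<and> restr a n = restr x n \<and> restr b n = restr y n \<and> restr w n = restr t n"
  using assms unfolding node_def by (metis length_restr)

lemma node_restr_le:
  assumes "node F (restr x n) (restr y n) (restr t n)" "m \<le> n"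
  shows "node F (restr x m) (restr y m) (restr t m)"
proof -
  obtain a b w where *: "((a, b), w) \<in> F" "restr a n = restr x n" "restr b n = restr y n" "restr w n = restr t n"
    using node_restrD[OF assms(1)] by blast
  show ?thesis
    unfolding node_def
    by (rule exI[of _ a], rule exI[of _ b], rule exI[of _ w], rule exI[of _ m])
       (use * assms(2) in \<open>auto simp: restr_eq_iff\<close>)
qed

text \<open>The first entry of \<open>s\<close> is the exact chain length, so it adds under
  concatenation and stays fixed along a branch; it also bounds the first entries of the witnesses.
  For empty \<open>s\<close> the length is free. Points and witnesses are infinite sequences of
  which only the first \<open>length s\<close> entries matter.\<close>

definition chain_node :: "(((nat \<Rightarrow> bool) \<times> (nat \<Rightarrow> bool)) \<times> (nat \<Rightarrow> nat)) set \<Rightarrow>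
    bool list \<Rightarrow> bool list \<Rightarrow> nat list \<Rightarrow> bool" where
  "chain_node F u v s \<longleftrightarrow> (\<exists>k x t. (s \<noteq> [] \<longrightarrow> k = s ! 0) \<and>
     u = restr (x 0) (length s) \<and> v = restr (x k) (length s) \<and>
     (\<forall>i<k. node F (restr (x i) (length s)) (restr (x (Suc i)) (length s)) (restr (t i) (length s))) \<and>
     (\<forall>j<length s. (\<Sum>i<k. t i j) \<le> s ! j))"

lemma chain_node_length: "chain_node F u v s \<Longrightarrow> length u = length s \<and> length v = length s"
  unfolding chain_node_def by auto

lemma chain_node_take:
  assumes "chain_node F u v s"
  shows "chain_node F (take m u) (take m v) (take m s)"
proof -
  obtain k x t where *: "s \<noteq> [] \<longrightarrow> k = s ! 0"
     "u = restr (x 0) (length s)" "v = restr (x k) (length s)"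
     "\<And>i. i < k \<Longrightarrow> node F (restr (x i) (length s)) (restr (x (Suc i)) (length s)) (restr (t i) (length s))"
     "\<And>j. j<length s \<Longrightarrow> (\<Sum>i<k. t i j) \<le> s ! j"
    using assms unfolding chain_node_def by blast
  show ?thesis unfolding chain_node_def
    by (rule exI[of _ k], rule exI[of _ x], rule exI[of _ t])
       (use * node_restr_le[OF *(4)] in \<open>auto simp: take_restr min.commute\<close>)
qed

lemma sum_lessThan_add:
  fixes f :: "nat \<Rightarrow> 'a::comm_monoid_add"
  shows "(\<Sum>i<m + n. f i) = (\<Sum>i<m. f i) + (\<Sum>i<n. f (m + i))"
  by (induction n) (auto simp: add.assoc)

text \<open>Concatenation of chains: lengths and sums of witnesses both add.\<close>

lemma chain_node_trans:
  assumes "chain_node F u v s" "chain_node F v w s'"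
  shows "chain_node F u w (seq_add s s')"
proof -
  obtain k x t where 1: "s \<noteq> [] \<longrightarrow> k = s ! 0"
     "u = restr (x 0) (length s)" "v = restr (x k) (length s)"
     "\<And>i. i < k \<Longrightarrow> node F (restr (x i) (length s)) (restr (x (Suc i)) (length s)) (restr (t i) (length s))"
     "\<And>j. j<length s \<Longrightarrow> (\<Sum>i<k. t i j) \<le> s ! j"
    using assms(1) unfolding chain_node_def by blast
  obtain k' x' t' where 2: "s' \<noteq> [] \<longrightarrow> k' = s' ! 0"
     "v = restr (x' 0) (length s')" "w = restr (x' k') (length s')"
     "\<And>i. i < k' \<Longrightarrow> node F (restr (x' i) (length s')) (restr (x' (Suc i)) (length s')) (restr (t' i) (length s'))"
     "\<And>j. j<length s' \<Longrightarrow> (\<Sum>i<k'. t' i j) \<le> s' ! j"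
    using assms(2) unfolding chain_node_def by blast
  have len: "length s' = length s" using 1(3) 2(2) by (metis length_restr)
  \<comment> \<open>The points \<open>x k\<close> and \<open>x' 0\<close> may differ, but they agree
    on the first \<open>length s\<close> entries. The nodes see no more, so either serves at index
    \<open>k\<close>.\<close>
  define X where "X i = (if i < k then x i else x' (i - k))" for i
  define T where "T i = (if i < k then t i else t' (i - k))" for i
  have X: "restr (X i) (length s) = restr (x i) (length s)" if "i \<le> k" for i
    using that 1(3) 2(2) len by (cases "i = k") (auto simp: X_def)
  have X': "X i = x' (i - k)" if "k \<le> i" for i using that by (simp add: X_def)
  have "node F (restr (X i) (length s)) (restr (X (Suc i)) (length s)) (restr (T i) (length s))"
    if "i < k + k'" for i
  proof (cases "i < k")
    case True
    then show ?thesis using 1(4)[of i] by (simp add: X T_def)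
  next
    case False
    then show ?thesis using 2(4)[of "i - k"] that len by (simp add: X' T_def Suc_diff_le)
  qed
  moreover have "(\<Sum>i<k + k'. T i j) \<le> s ! j + s' ! j" if "j < length s" for j
  proof -
    have "(\<Sum>i<k + k'. T i j) = (\<Sum>i<k. t i j) + (\<Sum>i<k'. t' i j)"
      unfolding sum_lessThan_add by (simp add: T_def)
    then show ?thesis using 1(5)[of j] 2(5)[of j] that len by simp
  qed
  moreover have "u = restr (X 0) (length s)" using 1(2) by (simp add: X)
  moreover have "w = restr (X (k + k')) (length s)" using 2(3) len by (simp add: X')
  moreover have "seq_add s s' \<noteq> [] \<longrightarrow> k + k' = seq_add s s' ! 0"
    using 1(1) 2(1) len by (auto simp flip: length_greater_0_conv)
  ultimately show ?thesis
    unfolding chain_node_def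
    by (intro exI[of _ "k + k'"] exI[of _ X] exI[of _ T]) simp
qed

context
  fixes F :: "(((nat \<Rightarrow> bool) \<times> (nat \<Rightarrow> bool)) \<times> (nat \<Rightarrow> nat)) set"
  assumes diag: "\<And>a w. ((a, a), w) \<in> F"
begin

lemma node_refl: "node F (restr x n) (restr x n) (restr t n)"
  unfolding node_def using diag by blast

text \<open>A constant chain of length \<open>s ! 0\<close> with zero witnesses, available because
  \<open>F\<close> contains the diagonal. Such chains serve as padding.\<close>

lemma chain_node_refl: "length u = length s \<Longrightarrow> chain_node F u u s"
  unfolding chain_node_def
  by (rule exI[of _ "s ! 0"], rule exI[of _ "\<lambda>_. (!) u"], rule exI[of _ "\<lambda>_ _. 0"])
     (use restr_nth[of u] node_refl[of "(!) u" "length s"] in auto)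

text \<open>Raising \<open>s\<close> to \<open>s'\<close> amounts to appending a constant chain at
  \<open>v\<close> with third component \<open>d\<close>, the difference of the two.\<close>

lemma chain_node_mono:
  assumes "chain_node F u v s" "seq_le s s'"
  shows "chain_node F u v s'"
proof -
  define d where "d = map (\<lambda>i. s' ! i - s ! i) [0..<length s]"
  have "s' = seq_add s d"
    using assms(2) by (intro nth_equalityI) (auto simp: d_def seq_le_def)
  moreover have "chain_node F v v d"
    using chain_node_length[OF assms(1)] by (intro chain_node_refl) (simp add: d_def)
  ultimately show ?thesis using chain_node_trans[OF assms(1)] by simp
qed

text \<open>One step from \<open>a\<close> to \<open>b\<close> with witness \<open>w\<close> is
  followed by \<open>w 0\<close> constant steps with zero witnesses. The first entry
  \<open>Suc (w 0)\<close> leaves room for the step even if \<open>w 0 = 0\<close>, and it still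
  bounds the first entry of \<open>w\<close>.\<close>

lemma chain_node_restr_if_mem:
  assumes "((a, b), w) \<in> F"
  shows "chain_node F (restr a n) (restr b n) (restr (w(0 := Suc (w 0))) n)"
proof -
  define x where "x i = (if i = 0 then a else b)" for i :: nat
  define t where "t i = (if i = 0 then w else (\<lambda>_. 0))" for i :: nat
  have sum: "(\<Sum>i<Suc k. t i j) = w j" for k j
    by (induction k) (auto simp: t_def)
  have "node F (restr (x i) n) (restr (x (Suc i)) n) (restr (t i) n)" for i
    using assms node_refl by (cases "i = 0") (auto simp: x_def t_def, auto simp: node_def)
  then show ?thesis
    unfolding chain_node_def
    by (intro exI[of _ "Suc (w 0)"] exI[of _ x] exI[of _ t])
       (auto simp: sum x_def simp del: sum.lessThan_Suc simp flip: length_0_conv)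
qed

end

text \<open>The entry \<open>\<beta> 0\<close> fixes the number of steps at all levels, and \<beta>
  bounds all witnesses, so the approximating chains lie in a compact set. Along a convergent
  subsequence each step tends to a member of the closed set \<open>F\<close>, and the limit points
  form an \<open>R\<close>-chain from \<open>a\<close> to \<open>b\<close>.\<close>

lemma mem_if_chain_node_restr:
  assumes F: "closed F" and R: "trans R" "refl R" and FR: "fst ` F \<subseteq> R"
    and q: "\<And>n. chain_node F (restr a n) (restr b n) (restr \<beta> n)"
  shows "(a, b) \<in> R"
proof -
  define k where "k = \<beta> 0"
  have "\<exists>x t. restr a n = restr (x 0) n \<and> restr b n = restr (x k) n \<and>
     (\<forall>i<k. node F (restr (x i) n) (restr (x (Suc i)) n) (restr (t i) n)) \<and>
     (\<forall>j<n. (\<Sum>i<k. t i j) \<le> \<beta> j)" for n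
  proof -
    \<comment> \<open>At level \<open>Suc n\<close> the segment of \<beta> is nonempty, so its first
      entry determines the chain length even for \<open>n = 0\<close>.\<close>
    obtain k' x t where *: "restr \<beta> (Suc n) \<noteq> [] \<longrightarrow> k' = restr \<beta> (Suc n) ! 0"
     "restr a (Suc n) = restr (x 0) (Suc n)" "restr b (Suc n) = restr (x k') (Suc n)"
     "\<And>i. i < k' \<Longrightarrow> node F (restr (x i) (Suc n)) (restr (x (Suc i)) (Suc n)) (restr (t i) (Suc n))"
     "\<And>j. j < Suc n \<Longrightarrow> (\<Sum>i<k'. t i j) \<le> restr \<beta> (Suc n) ! j"
      using q[of "Suc n"] unfolding chain_node_def length_restr by blast
    have "k' = k" using *(1) by (auto simp: k_def simp flip: length_0_conv)
    moreover have "(\<Sum>i<k'. t i j) \<le> \<beta> j" if "j < n" for j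
      using *(5)[of j] that by simp
    ultimately show ?thesis
      using *(2,3) node_restr_le[OF *(4), of _ n]
      by (intro exI[of _ x] exI[of _ t]) (auto simp: restr_eq_iff)
  qed
  then obtain x t where x0: "\<And>n. restr a n = restr (x n 0) n" and xk: "\<And>n. restr b n = restr (x n k) n"
    and c: "\<And>n i. i < k \<Longrightarrow> node F (restr (x n i) n) (restr (x n (Suc i)) n) (restr (t n i) n)"
    and t: "\<And>n j. j < n \<Longrightarrow> (\<Sum>i<k. t n i j) \<le> \<beta> j"
    by metis
  \<comment> \<open>Entries beyond step \<open>k\<close> or level \<open>n\<close> are
    unconstrained. Setting them to 0 bounds every entry by \<beta> and leaves the first
    \<open>n\<close> entries of each used witness intact.\<close>
  define t' where "t' n i j = (if i < k \<and> j < n then t n i j else 0)" for n i j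
  have "t' n i j \<le> \<beta> j" for n i j
  proof (cases "i < k \<and> j < n")
    case True
    then have "t n i j \<le> (\<Sum>i<k. t n i j)" by (intro member_le_sum) auto
    then show ?thesis using t[of j n] True by (simp add: t'_def)
  qed (auto simp: t'_def)
  then have "\<forall>n. (x n, t' n) \<in> UNIV \<times> {f. \<forall>i j. f i j \<le> \<beta> j}" by auto
  moreover have "seq_compact (UNIV \<times> {f :: nat \<Rightarrow> nat \<Rightarrow> nat. \<forall>i j. f i j \<le> \<beta> j} :: ((nat \<Rightarrow> nat \<Rightarrow> bool) \<times> _) set)"
    by (intro compact_imp_seq_compact compact_Times compact_UNIV_bool_functions compact_bounded_functions)
  ultimately obtain l r where r: "strict_mono (r :: nat \<Rightarrow> nat)" and l: "((\<lambda>n. (x n, t' n)) \<circ> r) \<longlonglongrightarrow> l"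
    unfolding seq_compact_def by meson
  have lx: "(\<lambda>m. x (r m) i) \<longlonglongrightarrow> fst l i" for i
    using tendsto_fst[OF l] by (simp add: tendsto_fun_iff o_def)
  have lt: "(\<lambda>m. t' (r m) i) \<longlonglongrightarrow> snd l i" for i
    using tendsto_snd[OF l] by (simp add: tendsto_fun_iff o_def)
  \<comment> \<open>The members of \<open>F\<close> behind the \<open>i\<close>-th nodes agree with
    the chain on the first \<open>n\<close> entries only, which suffices for them to have the same
    limits.\<close>
  have step: "(fst l i, fst l (Suc i)) \<in> R" if "i < k" for i
  proof -
    have "\<forall>n. \<exists>a b w. ((a, b), w) \<in> F \<and> restr a n = restr (x n i) n \<and>
        restr b n = restr (x n (Suc i)) n \<and> restr w n = restr (t n i) n"
      using c[OF that] node_restrD by blast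
    then obtain p q w where pq: "\<And>n. ((p n, q n), w n) \<in> F"
      "\<And>n. restr (p n) n = restr (x n i) n" "\<And>n. restr (q n) n = restr (x n (Suc i)) n"
      "\<And>n. restr (w n) n = restr (t n i) n"
      by metis
    have "restr (w n) n = restr (t' n i) n" for n
      using pq(4)[of n] that by (simp add: restr_eq_iff t'_def)
    then have "(\<lambda>m. ((p (r m), q (r m)), w (r m))) \<longlonglongrightarrow> ((fst l i, fst l (Suc i)), snd l i)"
      using pq by (intro tendsto_Pair tendsto_if_restr_eq[OF _ r lx] tendsto_if_restr_eq[OF _ r lt])
    then have "((fst l i, fst l (Suc i)), snd l i) \<in> F"
      by (rule closed_sequentially[OF F, rotated]) (simp add: pq)
    then show ?thesis using FR by force
  qed
  have "i \<le> k \<Longrightarrow> (fst l 0, fst l i) \<in> R" for i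
  proof (induction i)
    case 0 show ?case using R(2) by (simp add: refl_on_def)
  next
    case (Suc i) then show ?case using step[of i] R(1) by (auto elim: transE)
  qed
  moreover have "a = fst l 0"
  proof -
    have "(\<lambda>m. a) \<longlonglongrightarrow> fst l 0"
      by (rule tendsto_if_restr_eq[OF _ r lx, where p = "\<lambda>_. a"]) (rule x0)
    then show ?thesis by (simp add: tendsto_fun_iff fun_eq_iff tendsto_const_iff)
  qed
  moreover have "b = fst l k"
  proof -
    have "(\<lambda>m. b) \<longlonglongrightarrow> fst l k"
      by (rule tendsto_if_restr_eq[OF _ r lx, where p = "\<lambda>_. b"]) (rule xk)
    then show ?thesis by (simp add: tendsto_fun_iff fun_eq_iff tendsto_const_iff)
  qed
  ultimately show ?thesis by simp
qed

section \<open>Fibres and pruning\<close>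

text \<open>Dead ends are extended rather than removed: once outside \<open>T\<close>, a node goes
  on with \<open>False\<close> and arbitrary numbers. Membership of a node thus depends on finitely
  many values of \<open>T\<close>, which keeps the operation Borel.\<close>

definition prune :: "tree \<Rightarrow> tree" where
  "prune T = (\<lambda>(u, s). length u = length s \<and>
     (\<exists>m\<le>length u. T (take m u, take m s) \<and> (\<forall>i. m \<le> i \<and> i < length u \<longrightarrow> \<not> u ! i)))"

lemma prune_iff:
  "prune T (u, s) \<longleftrightarrow> length u = length s \<and>
     (\<exists>m\<le>length u. T (take m u, take m s) \<and> (\<forall>i. m \<le> i \<and> i < length u \<longrightarrow> \<not> u ! i))"
  by (simp add: prune_def)

lemma seq_le_take: "seq_le s t \<Longrightarrow> seq_le (take m s) (take m t)"
  by (auto simp: seq_le_def)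

lemma prune_in_Tpr:
  assumes "normal_tree T"
  shows "prune T \<in> Tpr"
proof -
  have nil: "T ([], [])" and up: "\<And>u s t. T (u, s) \<Longrightarrow> seq_le s t \<Longrightarrow> T (u, t)"
    and tk: "\<And>u s n. T (u, s) \<Longrightarrow> T (take n u, take n s)"
    using assms unfolding normal_tree_def by blast+
  have len: "prune T (u, s) \<Longrightarrow> length u = length s" for u s
    by (simp add: prune_def)
  have ptk: "prune T (take n u, take n s)" if p: "prune T (u, s)" for u s n
  proof -
    obtain m where m: "m \<le> length u" "T (take m u, take m s)" "\<forall>i. m \<le> i \<and> i < length u \<longrightarrow> \<not> u ! i"
      and l: "length u = length s"
      using p unfolding prune_iff by blast
    have "T (take (min m n) u, take (min m n) s)"
      using tk[OF m(2), of n] by (simp only: take_take min.commute)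
    then show ?thesis
      unfolding prune_iff using l m(1,3)
      by (auto intro!: exI[of _ "min m n"])
  qed
  have pup: "prune T (u, t)" if p: "prune T (u, s)" and le: "seq_le s t" for u s t
  proof -
    obtain m where "m \<le> length u" "T (take m u, take m s)" "\<forall>i. m \<le> i \<and> i < length u \<longrightarrow> \<not> u ! i"
      using p unfolding prune_iff by blast
    then show ?thesis
      using p le up[OF _ seq_le_take[OF le]] by (auto simp: prune_iff seq_le_def)
  qed
  have pnil: "prune T ([], [])" using nil by (simp add: prune_def)
  have "\<exists>v w. v \<noteq> [] \<and> w \<noteq> [] \<and> prune T (u @ v, s @ w)" if p: "prune T (u, s)" for u s
  proof -
    obtain m where m: "m \<le> length u" "T (take m u, take m s)" "\<forall>i. m \<le> i \<and> i < length u \<longrightarrow> \<not> u ! i"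
      and l: "length u = length s"
      using p unfolding prune_iff by blast
    have "prune T (u @ [False], s @ [0])"
      unfolding prune_iff using m l by (auto intro!: exI[of _ m] simp: nth_append less_Suc_eq)
    then show ?thesis by blast
  qed
  then have "pruned (prune T)" by (auto simp: pruned_def)
  moreover have "normal_tree (prune T)"
    unfolding normal_tree_def using len pnil ptk pup by blast
  ultimately show ?thesis using pnil by (simp add: Tpr_def)
qed

text \<open>Adding \<alpha> commutes with taking initial segments, so the same shift works.\<close>

lemma le_S_prune:
  assumes "le_S S T"
  shows "le_S (prune S) (prune T)"
proof -
  obtain \<alpha> where \<alpha>: "\<And>u s. S (u, s) \<Longrightarrow> T (u, seq_add s (restr \<alpha> (length s)))"
    using assms unfolding le_S_def by blast
  have "prune T (u, seq_add s (restr \<alpha> (length s)))" if p: "prune S (u, s)" for u s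
  proof -
    obtain m where m: "m \<le> length u" "S (take m u, take m s)" "\<forall>i. m \<le> i \<and> i < length u \<longrightarrow> \<not> u ! i"
      and l: "length u = length s"
      using p unfolding prune_iff by blast
    have "take m (seq_add s (restr \<alpha> (length s))) = seq_add (take m s) (restr \<alpha> (length (take m s)))"
      by (rule nth_equalityI) auto
    then show ?thesis
      using m l \<alpha>[OF m(2)] by (auto simp: prune_iff)
  qed
  then show ?thesis unfolding le_S_def by blast
qed

text \<open>A value \<open>True\<close> at some \<open>i \<ge> n\<close> forces the part of the node
  of length \<open>Suc i\<close> that lies in \<open>T\<close> to be longer than \<open>i\<close>.
  Hence the node of length \<open>n\<close> is in \<open>T\<close>.\<close>

lemma A_tree_prune_iff:
  assumes "normal_tree T" and inf: "\<And>n. \<exists>i\<ge>n. a i"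
  shows "a \<in> A_tree (prune T) \<longleftrightarrow> a \<in> A_tree T"
proof
  assume "a \<in> A_tree T"
  then obtain \<beta> where "\<And>n. T (restr a n, restr \<beta> n)" by (auto simp: A_tree_def)
  then have "prune T (restr a n, restr \<beta> n)" for n
    by (auto simp: prune_iff intro!: exI[of _ n] simp: take_restr)
  then show "a \<in> A_tree (prune T)" by (auto simp: A_tree_def)
next
  assume "a \<in> A_tree (prune T)"
  then obtain \<beta> where \<beta>: "\<And>n. prune T (restr a n, restr \<beta> n)" by (auto simp: A_tree_def)
  have "T (restr a n, restr \<beta> n)" for n
  proof -
    obtain i where i: "n \<le> i" "a i" using inf by blast
    obtain m where m: "m \<le> Suc i" "T (restr a m, restr \<beta> m)" "\<forall>j. m \<le> j \<and> j < Suc i \<longrightarrow> \<not> a j"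
      using \<beta>[of "Suc i"] by (auto simp: prune_iff take_restr min_def split: if_splits)
    have "n \<le> m" using m(3)[rule_format, of i] i by linarith
    moreover have "T (take n (restr a m), take n (restr \<beta> m))"
      using assms(1) m(2) unfolding normal_tree_def by blast
    ultimately show ?thesis by (simp add: take_restr min_def split: if_splits)
  qed
  then show "a \<in> A_tree T" by (auto simp: A_tree_def)
qed

text \<open>Chains end at \<open>a\<close>, so a further step from \<open>a\<close> to
  \<open>b\<close> can be appended at this end without changing the projected coordinate
  \<open>u\<close>.\<close>

definition chain_fibre :: "(((nat \<Rightarrow> bool) \<times> (nat \<Rightarrow> bool)) \<times> (nat \<Rightarrow> nat)) set \<Rightarrow> (nat \<Rightarrow> bool) \<Rightarrow> tree" where
  "chain_fibre F a = (\<lambda>(u, s). chain_node F u (restr a (length s)) s)"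

text \<open>Shifting a branch by \<alpha> gives a branch over the same point. Hence
  \<open>le_S\<close> and \<open>nsub_S\<close> exclude each other.\<close>

lemma le_S_imp_A_tree_subset:
  assumes "le_S S T"
  shows "A_tree S \<subseteq> A_tree T"
proof
  obtain \<alpha> where \<alpha>: "\<And>u s. S (u, s) \<Longrightarrow> T (u, seq_add s (restr \<alpha> (length s)))"
    using assms unfolding le_S_def by blast
  fix a assume "a \<in> A_tree S"
  then obtain \<beta> where "\<And>n. S (restr a n, restr \<beta> n)" by (auto simp: A_tree_def)
  then have "T (restr a n, seq_add (restr \<beta> n) (restr \<alpha> n))" for n using \<alpha> by fastforce
  moreover have "seq_add (restr \<beta> n) (restr \<alpha> n) = restr (\<lambda>i. \<beta> i + \<alpha> i) n" for n
    by (rule nth_equalityI) auto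
  ultimately show "a \<in> A_tree T" by (auto simp: A_tree_def)
qed

context
  fixes F :: "(((nat \<Rightarrow> bool) \<times> (nat \<Rightarrow> bool)) \<times> (nat \<Rightarrow> nat)) set"
  assumes diag: "\<And>a w. ((a, a), w) \<in> F"
begin

lemma normal_tree_chain_fibre: "normal_tree (chain_fibre F a)"
  unfolding normal_tree_def
proof (intro conjI allI impI)
  fix u s n assume "chain_fibre F a (u, s)"
  then show "chain_fibre F a (take n u, take n s)"
    using chain_node_take[of F u "restr a (length s)" s n] by (simp add: chain_fibre_def take_restr min.commute)
next
  fix u s t assume "chain_fibre F a (u, s) \<and> seq_le s t"
  then show "chain_fibre F a (u, t)"
    using chain_node_mono[OF diag, of u "restr a (length s)" s t] by (auto simp: chain_fibre_def seq_le_def)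
next
  show "chain_fibre F a ([], [])" using chain_node_refl[OF diag, of "[]" "[]"] by (simp add: chain_fibre_def restr_def)
qed (use chain_node_length in \<open>auto simp: chain_fibre_def\<close>)

text \<open>Appending the chain from \<open>a\<close> to \<open>b\<close> adds its third component,
  which is the same for all nodes of the fibre and serves as the shift.\<close>

lemma le_S_chain_fibre:
  assumes "((a, b), w) \<in> F"
  shows "le_S (chain_fibre F a) (chain_fibre F b)"
  unfolding le_S_def chain_fibre_def
  using chain_node_trans[OF _ chain_node_restr_if_mem[OF diag assms]]
  by (intro exI[of _ "w(0 := Suc (w 0))"]) simp

lemma mem_A_tree_chain_fibre: "((a, b), w) \<in> F \<Longrightarrow> a \<in> A_tree (chain_fibre F b)"
  unfolding A_tree_def chain_fibre_def
  using chain_node_restr_if_mem[OF diag, of a b w] by (simp del: fun_upd_apply) blast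

end

lemma A_tree_chain_fibreD:
  assumes "closed F" "trans R" "refl R" "fst ` F \<subseteq> R" "a \<in> A_tree (chain_fibre F b)"
  shows "(a, b) \<in> R"
  using assms(5) by (auto simp: A_tree_def chain_fibre_def intro: mem_if_chain_node_restr[OF assms(1-4)])

section \<open>Hardness\<close>

text \<open>Balls of radius \<open>1 / real (Suc j)\<close> about a countable dense set separate
  points. The whole space at even positions makes every code true infinitely often, as required for
  pruning to be harmless.\<close>

lemma standard_borel_separating_sequence:
  assumes "standard_borel M"
  shows "\<exists>B :: nat \<Rightarrow> 'a set. (\<forall>n. B n \<in> sets M) \<and> (\<forall>n. B (2 * n) = space M) \<and>
    (\<forall>x\<in>space M. \<forall>y\<in>space M. (\<forall>n. x \<in> B n \<longleftrightarrow> y \<in> B n) \<longrightarrow> x = y)"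
proof -
  obtain X where X: "completely_metrizable_space X" "separable_space X" "space M = topspace X"
    "sets M = sigma_sets (topspace X) {U. openin X U}"
    using assms unfolding standard_borel_def Polish_space_def by blast
  obtain S d where "Metric_space S d" and Xd: "X = Metric_space.mtopology S d"
    using X(1) unfolding completely_metrizable_space_def by blast
  interpret Metric_space S d by fact
  obtain C where C: "countable C" "X closure_of C = topspace X"
    using X(2) unfolding separable_space_def by blast
  define B where "B n = (if even n then space M else
     (case prod_decode (n div 2) of (i, j) \<Rightarrow> mball (from_nat_into C i) (1 / real (Suc j))))" for n
  have B_odd: "B (2 * prod_encode (i, j) + 1) = mball (from_nat_into C i) (1 / real (Suc j))" for i j
    by (simp add: B_def)
  show ?thesis
  proof (intro exI conjI allI ballI impI)
    show "B n \<in> sets M" for n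
      by (auto simp: B_def X(4) Xd split: prod.splits intro: sigma_sets.Basic)
         (use sets.top[of M] X Xd in simp)
    show "B (2 * n) = space M" for n by (simp add: B_def)
    fix x y assume x: "x \<in> space M" and y: "y \<in> space M" and eq: "\<forall>n. x \<in> B n \<longleftrightarrow> y \<in> B n"
    have xS: "x \<in> S" "y \<in> S" using x y X(3) Xd by auto
    show "x = y"
    proof (rule ccontr)
      assume "x \<noteq> y"
      then have "0 < d x y / 2" using xS by simp
      \<comment> \<open>Two points of a common ball of this radius are closer than
        \<open>d x y\<close>.\<close>
      then obtain j where j: "1 / real (Suc j) < d x y / 2"
        using reals_Archimedean by (metis inverse_eq_divide)
      have "x \<in> mtopology closure_of C" using C(2) x X(3) Xd by simp
      then have "\<forall>r>0. \<exists>c\<in>C. c \<in> mball x r" unfolding metric_closure_of by simp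
      moreover have "0 < 1 / real (Suc j)" by simp
      ultimately obtain c where c: "c \<in> C" "c \<in> mball x (1 / real (Suc j))" by blast
      obtain i where "from_nat_into C i = c" using C(1) c(1) by (metis from_nat_into_surj)
      then have "x \<in> mball c (1 / real (Suc j)) \<longleftrightarrow> y \<in> mball c (1 / real (Suc j))"
        using eq[rule_format, of "2 * prod_encode (i, j) + 1"] by (simp only: B_odd)
      moreover have "x \<in> mball c (1 / real (Suc j))" using c(2) by (simp add: commute)
      ultimately have "d c y < 1 / real (Suc j)" "d x c < 1 / real (Suc j)" "c \<in> S"
        using c(2) by auto
      then show False using triangle[of x c y] xS j by linarith
    qed
  qed
qed

section \<open>Measurability of the reduction\<close>

lemma measurable_restr:
  fixes a :: "'a \<Rightarrow> nat \<Rightarrow> 'b::countable"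
  assumes [measurable]: "\<And>n. (\<lambda>x. a x n) \<in> M \<rightarrow>\<^sub>M count_space UNIV"
  shows "(\<lambda>x. restr (a x) n) \<in> M \<rightarrow>\<^sub>M count_space UNIV"
  unfolding measurable_count_space_eq2_countable
proof (intro conjI ballI)
  fix l :: "'b list"
  have "(\<lambda>x. restr (a x) n) -` {l} \<inter> space M = {x \<in> space M. n = length l \<and> (\<forall>i<n. a x i = l ! i)}"
    by (auto simp: list_eq_iff_nth_eq)
  also have "\<dots> \<in> sets M" by measurable
  finally show "(\<lambda>x. restr (a x) n) -` {l} \<inter> space M \<in> sets M" .
qed auto

text \<open>Each coordinate of the tree depends on finitely many initial segments of
  \<open>a x\<close>. These range over a countable discrete space, on which every predicate is
  measurable.\<close>

lemma measurable_prune_chain_fibre: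
  assumes "\<And>n. Measurable.pred M (\<lambda>x. a x n)"
    and "\<And>x. x \<in> space M \<Longrightarrow> prune (chain_fibre F (a x)) \<in> Tpr"
  shows "(\<lambda>x. prune (chain_fibre F (a x))) \<in> M \<rightarrow>\<^sub>M Tpr_space"
  unfolding Tpr_space_def
proof (rule measurable_restrict_space2)
  show "(\<lambda>x. prune (chain_fibre F (a x))) \<in> M \<rightarrow>\<^sub>M borel"
  proof (rule measurable_coordinatewise_then_product)
    fix p :: "bool list \<times> nat list"
    obtain u s where p: "p = (u, s)" by (cases p)
    have [measurable]: "Measurable.pred M (\<lambda>x. chain_fibre F (a x) (v, t))" for v t
      unfolding chain_fibre_def prod.case
      by (rule measurable_compose[OF measurable_restr[of a] measurable_count_space])
         (rule assms(1))
    have "Measurable.pred M (\<lambda>x. prune (chain_fibre F (a x)) (u, s))"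
      unfolding prune_iff by measurable
    then show "(\<lambda>x. prune (chain_fibre F (a x)) p) \<in> borel_measurable M"
      unfolding p by (rule measurable_compose[OF _ borel_measurable_count_space])
  qed
qed (use assms(2) in auto)

lemma analytic_quasiorder_hom:
  assumes M: "standard_borel M" and R: "analytic_quasiorder M R"
  obtains f where "f \<in> M \<rightarrow>\<^sub>M Tpr_space" "\<And>x y. (x, y) \<in> R \<Longrightarrow> le_S (f x) (f y)"
    "\<And>x y. x \<in> space M \<Longrightarrow> y \<in> space M \<Longrightarrow> (x, y) \<notin> R \<Longrightarrow> nsub_S (f x) (f y)"
proof -
  obtain B :: "nat \<Rightarrow> 'a set" where B: "\<And>n. B n \<in> sets M" "\<And>n. B (2 * n) = space M"
    "\<And>x y. x \<in> space M \<Longrightarrow> y \<in> space M \<Longrightarrow> \<forall>n. x \<in> B n \<longleftrightarrow> y \<in> B n \<Longrightarrow> x = y"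
    using standard_borel_separating_sequence[OF M] by blast
  define \<phi> where "\<phi> x n \<longleftrightarrow> x \<in> B n" for x n
  have inj: "x = y" if "\<phi> x = \<phi> y" "x \<in> space M" "y \<in> space M" for x y
    using B(3)[OF that(2,3)] that(1) by (simp add: \<phi>_def fun_eq_iff)
  have Rsub: "R \<subseteq> space M \<times> space M" and Rrefl: "\<And>x. x \<in> space M \<Longrightarrow> (x, x) \<in> R" and Rtrans: "trans R"
    and Ran: "analytic_set (M \<Otimes>\<^sub>M M) R"
    using R unfolding analytic_quasiorder_def preorder_on_def refl_on_def by auto
  \<comment> \<open>A Borel parametrization of \<open>R\<close> followed by the code is Borel in
    each coordinate, so the coded relation is the range of a pair of such maps.\<close>
  have "suslin ((\<lambda>(x, y). (\<phi> x, \<phi> y)) ` R)"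
  proof (cases "R = {}")
    case True
    then show ?thesis by (simp add: suslin_closed)
  next
    case False
    then obtain f where f: "f \<in> (borel :: (nat \<Rightarrow> nat) measure) \<rightarrow>\<^sub>M M \<Otimes>\<^sub>M M" "range f = R"
      using Ran unfolding analytic_set_def by blast
    have "{z. \<phi> (fst (f z)) n} \<in> sets borel" for n
      using measurable_sets[OF measurable_compose[OF f(1) measurable_fst] B(1)[of n]]
      by (simp add: \<phi>_def vimage_def)
    moreover have "{z. \<phi> (snd (f z)) n} \<in> sets borel" for n
      using measurable_sets[OF measurable_compose[OF f(1) measurable_snd] B(1)[of n]]
      by (simp add: \<phi>_def vimage_def)
    ultimately have "suslin (range (\<lambda>z. (\<phi> (fst (f z)), \<phi> (snd (f z)))))"
      by (rule suslin_range_Pair)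
    also have "range (\<lambda>z. (\<phi> (fst (f z)), \<phi> (snd (f z)))) = (\<lambda>(x, y). (\<phi> x, \<phi> y)) ` R"
      unfolding f(2)[symmetric] image_image by (simp add: case_prod_beta)
    finally show ?thesis .
  qed
  then obtain F0 :: "(((nat \<Rightarrow> bool) \<times> (nat \<Rightarrow> bool)) \<times> (nat \<Rightarrow> nat)) set"
    where F0: "closed F0" "(\<lambda>(x, y). (\<phi> x, \<phi> y)) ` R = fst ` F0"
    unfolding suslin_def by blast
  \<comment> \<open>The diagonal is added with every witness, also at sequences that code no point
    of \<open>M\<close>; this allows padding, and \<open>R'\<close> is the matching enlargement of
    the coded relation.\<close>
  define D :: "(((nat \<Rightarrow> bool) \<times> (nat \<Rightarrow> bool)) \<times> (nat \<Rightarrow> nat)) set"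
    where "D = (\<Inter>n. {p. fst (fst p) n = snd (fst p) n})"
  define F where "F = F0 \<union> D"
  define R' where "R' = (\<lambda>(x, y). (\<phi> x, \<phi> y)) ` R \<union> Id"
  have mem_D: "((a, b), w) \<in> D \<longleftrightarrow> a = b" for a b w by (auto simp: D_def fun_eq_iff)
  have "closed D" unfolding D_def
    by (intro closed_INT ballI closed_Collect_eq)
       (rule continuous_on_product_then_coordinatewise, intro continuous_on_fst continuous_on_snd continuous_on_id)+
  then have F: "closed F" unfolding F_def using F0(1) by blast
  have diag: "((a, a), w) \<in> F" for a w by (simp add: F_def mem_D)
  have FR: "fst ` F \<subseteq> R'"
    unfolding F_def R'_def image_Un F0(2) by (auto simp: mem_D)
  have "refl R'" by (auto simp: R'_def refl_on_def)
  have "trans R'"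
  proof (rule transI)
    fix a b c assume ab: "(a, b) \<in> R'" and bc: "(b, c) \<in> R'"
    show "(a, c) \<in> R'"
    proof (cases "a = b \<or> b = c")
      case True then show ?thesis using ab bc by auto
    next
      case False
      then obtain x y y' z where *: "(x, y) \<in> R" "(y', z) \<in> R" "a = \<phi> x" "b = \<phi> y" "b = \<phi> y'" "c = \<phi> z"
        using ab bc by (auto simp: R'_def)
      then have "y = y'" using inj Rsub by blast
      then have "(x, z) \<in> R" using * Rtrans by (blast elim: transE)
      then show ?thesis using * by (auto simp: R'_def)
    qed
  qed
  define f where "f x = prune (chain_fibre F (\<phi> x))" for x
  have normal: "normal_tree (chain_fibre F a)" for a using normal_tree_chain_fibre[of F] diag by blast
  have "f \<in> M \<rightarrow>\<^sub>M Tpr_space" unfolding f_def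
    by (rule measurable_prune_chain_fibre) (use B(1) prune_in_Tpr[OF normal] in \<open>auto simp: \<phi>_def\<close>)
  moreover have "le_S (f x) (f y)" if "(x, y) \<in> R" for x y
  proof -
    have "(\<phi> x, \<phi> y) \<in> fst ` F0" using that F0(2) by force
    then obtain w where "((\<phi> x, \<phi> y), w) \<in> F0" by auto
    then have "((\<phi> x, \<phi> y), w) \<in> F" by (simp add: F_def)
    then show ?thesis unfolding f_def by (intro le_S_prune le_S_chain_fibre diag)
  qed
  moreover have "nsub_S (f x) (f y)" if x: "x \<in> space M" and y: "y \<in> space M" and xy: "(x, y) \<notin> R" for x y
  proof -
    have "(\<phi> x, \<phi> y) \<notin> R'"
    proof
      assume "(\<phi> x, \<phi> y) \<in> R'"
      then consider "\<phi> x = \<phi> y" | x' y' where "(x', y') \<in> R" "\<phi> x = \<phi> x'" "\<phi> y = \<phi> y'"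
        by (auto simp: R'_def)
      then show False
      proof cases
        case 1
        then show False using inj[OF 1 x y] xy Rrefl[OF x] by simp
      next
        case 2
        then have "x' \<in> space M" "y' \<in> space M" using Rsub by auto
        then show False using inj[OF 2(2) x] inj[OF 2(3) y] 2(1) xy by simp
      qed
    qed
    then have "\<phi> x \<notin> A_tree (chain_fibre F (\<phi> y))"
      using A_tree_chain_fibreD[OF F \<open>trans R'\<close> \<open>refl R'\<close> FR] by blast
    moreover have "\<phi> x \<in> A_tree (chain_fibre F (\<phi> x))"
      using mem_A_tree_chain_fibre[OF diag diag] .
    \<comment> \<open>The even positions of the code make it immune to the branches added by
      pruning.\<close>
    moreover have "\<exists>i\<ge>n. \<phi> x i" for n
      by (rule exI[of _ "2 * n"]) (use B(2)[of n] x in \<open>simp add: \<phi>_def\<close>)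
    ultimately show ?thesis
      unfolding nsub_S_def f_def using A_tree_prune_iff[OF normal, of "\<phi> x"] by blast
  qed
  ultimately show thesis by (rule that)
qed

section \<open>Membership\<close>

text \<open>With the shift made explicit the relation becomes Borel, and \<open>le_S\<close> is its
  projection.\<close>

definition le_via :: "tree \<Rightarrow> tree \<Rightarrow> (nat \<Rightarrow> nat) \<Rightarrow> bool" where
  "le_via S T \<alpha> \<longleftrightarrow> (\<forall>u s. S (u, s) \<longrightarrow> T (u, seq_add s (restr \<alpha> (length s))))"

lemma le_S_iff_le_via: "le_S S T \<longleftrightarrow> (\<exists>\<alpha>. le_via S T \<alpha>)"
  by (simp add: le_S_def le_via_def)

lemma le_via_refl: "le_via S S (\<lambda>_. 0)"
  by (simp add: le_via_def seq_add_restr_0)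

lemma le_S_refl: "le_S S S"
  using le_via_refl le_S_iff_le_via by blast

lemma le_S_trans:
  assumes "le_S S T" "le_S T U"
  shows "le_S S U"
proof -
  obtain \<alpha> \<beta> where *: "le_via S T \<alpha>" "le_via T U \<beta>" using assms le_S_iff_le_via by blast
  have "U (u, seq_add s (restr (\<lambda>i. \<alpha> i + \<beta> i) (length s)))" if "S (u, s)" for u s
  proof -
    have "T (u, seq_add s (restr \<alpha> (length s)))" using * that by (simp add: le_via_def)
    then have "U (u, seq_add (seq_add s (restr \<alpha> (length s))) (restr \<beta> (length s)))"
      using *(2) unfolding le_via_def by fastforce
    then show ?thesis by (simp add: seq_add_restr_assoc)
  qed
  then show ?thesis unfolding le_S_def by blast
qed

lemma pred_le_via:
  assumes [measurable]: "\<And>p. Measurable.pred N (\<lambda>z. S z p)" "\<And>p. Measurable.pred N (\<lambda>z. T z p)"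
    and "\<And>n. (\<lambda>z. \<alpha> z n) \<in> N \<rightarrow>\<^sub>M count_space UNIV"
  shows "Measurable.pred N (\<lambda>z. le_via (S z) (T z) (\<alpha> z))"
proof -
  have [measurable]: "(\<lambda>z. restr (\<alpha> z) n) \<in> N \<rightarrow>\<^sub>M count_space UNIV" for n
    using assms(3) by (rule measurable_restr)
  \<comment> \<open>The initial segment is replaced by a quantified value \<open>l\<close> from a
    countable type, so that \<open>T z\<close> is evaluated at a node independent of
    \<open>z\<close>.\<close>
  have "le_via (S z) (T z) (\<alpha> z) \<longleftrightarrow>
    (\<forall>u s l. S z (u, s) \<longrightarrow> restr (\<alpha> z) (length s) = l \<longrightarrow> T z (u, seq_add s l))" for z
    by (auto simp: le_via_def)
  then show ?thesis by simp
qed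

section \<open>Transport of the space of trees to the reals\<close>

lemma ex_inj_tree_real: "\<exists>g :: tree \<Rightarrow> real. inj g"
proof -
  obtain h :: "nat set \<Rightarrow> real" where h: "bij h"
    using nat_sets_eqpoll_reals unfolding eqpoll_def by auto
  have "inj (\<lambda>T :: tree. h (to_nat ` {p. T p}))"
  proof (rule injI)
    fix S T :: tree assume "h (to_nat ` {p. S p}) = h (to_nat ` {p. T p})"
    then have "to_nat ` {p. S p} = to_nat ` {p. T p}" using bij_is_inj[OF h] by (simp add: inj_eq)
    then have "{p. S p} = {p. T p}" by (simp add: inj_image_eq_iff)
    then show "S = T" by (simp add: set_eq_iff fun_eq_iff)
  qed
  then show ?thesis by blast
qed

lemma second_countable_euclidean: "second_countable (euclidean :: 'a::second_countable_topology topology)"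
proof -
  obtain B :: "'a set set" where B: "countable B" "topological_basis B"
    using ex_countable_basis by blast
  have "\<exists>V\<in>B. x \<in> V \<and> V \<subseteq> U" if "open U" "x \<in> U" for U x
    using topological_basisE[OF B(2) that] by metis
  then show ?thesis unfolding second_countable_def
    using B topological_basis_open[OF B(2)] by (intro exI[of _ B]) auto
qed

lemma Polish_space_tree: "Polish_space (euclidean :: tree topology)"
proof -
  have "completely_metrizable_space (euclidean :: tree topology)"
    unfolding euclidean_product_topology[symmetric]
    by (auto simp: completely_metrizable_space_product_topology euclidean_eq_discrete_topology
        completely_metrizable_space_discrete_topology)
  then show ?thesis
    by (simp add: Polish_space_def second_countable_imp_separable_space second_countable_euclidean)
qed

lemma Polish_space_homeomorphic:
  "X homeomorphic_space Y \<Longrightarrow> Polish_space X \<longleftrightarrow> Polish_space Y"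
  by (simp add: Polish_space_def homeomorphic_completely_metrizable_space homeomorphic_separable_space)

text \<open>The topology is pushed forward along \<open>g\<close>, which makes
  \<open>range g\<close> a homeomorphic copy. Any injection will do, since the resulting structure
  is unrelated to one already present on the target type.\<close>

lemma standard_borel_copy:
  fixes g :: "'a::topological_space \<Rightarrow> 'b"
  assumes g: "inj g" and P: "Polish_space (euclidean :: 'a topology)"
  obtains M where "standard_borel M" "space M = range g" "g \<in> borel \<rightarrow>\<^sub>M M"
proof -
  define X where "X = pullback_topology (range g) (inv g) euclidean"
  have op: "openin X S \<longleftrightarrow> (\<exists>U. open U \<and> S = g ` U)" for S
  proof -
    have "inv g -` U \<inter> range g = g ` U" for U using g by (auto simp: image_iff)
    then show ?thesis by (simp add: X_def openin_pullback_topology)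
  qed
  have top: "topspace X = range g" by (simp add: X_def topspace_pullback_topology)
  have "homeomorphic_map euclidean X g"
    unfolding homeomorphic_eq_everything_map continuous_map_def open_map_def closed_map_def
  proof (intro conjI)
    show "\<forall>U. openin X U \<longrightarrow> openin euclidean {x \<in> topspace euclidean. g x \<in> U}"
      using g by (auto simp: op inj_image_mem_iff)
    show "\<forall>C. closedin euclidean C \<longrightarrow> closedin X (g ` C)"
    proof (intro allI impI)
      fix C :: "'a set" assume "closedin euclidean C"
      then have "open (- C)" by (simp add: closed_def)
      moreover have "range g - g ` C = g ` (- C)" using g by (simp add: image_set_diff Compl_eq_Diff_UNIV)
      ultimately show "closedin X (g ` C)" unfolding closedin_def top op by auto
    qed
  qed (use g in \<open>auto simp: op top\<close>)
  then have "Polish_space X"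
    using P Polish_space_homeomorphic homeomorphic_map_imp_homeomorphic_space by blast
  define M where "M = sigma (topspace X) {U. openin X U}"
  have M: "space M = topspace X" "sets M = sigma_sets (topspace X) {U. openin X U}"
    unfolding M_def by (auto intro!: space_measure_of sets_measure_of dest: openin_subset)
  show thesis
  proof
    show "standard_borel M" unfolding standard_borel_def using \<open>Polish_space X\<close> M by blast
    show "space M = range g" by (simp add: M top)
    show "g \<in> borel \<rightarrow>\<^sub>M M"
    proof (rule measurable_sigma_sets[OF M(2)])
      fix S assume "S \<in> {U. openin X U}"
      then obtain U where "open U" "S = g ` U" by (auto simp: op)
      then show "g -` S \<inter> space borel \<in> sets borel" using g by (simp add: inj_vimage_image_eq)
    qed (use openin_subset[of X] top in blast)+
  qed
qed

text \<open>One sequence codes two trees and a parameter, and a Borel map decodes it. The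
  measurability of \<open>P\<close> is assumed for arbitrary measurable families so that it applies
  to the decoded ones.\<close>

lemma analytic_set_tree_relation:
  fixes g :: "tree \<Rightarrow> 'b"
  assumes g: "g \<in> borel \<rightarrow>\<^sub>M M"
    and P: "\<And>S T \<alpha>. (\<And>p. Measurable.pred borel (\<lambda>z. S z p)) \<Longrightarrow> (\<And>p. Measurable.pred borel (\<lambda>z. T z p)) \<Longrightarrow>
      (\<And>n. (\<lambda>z. \<alpha> z n) \<in> borel \<rightarrow>\<^sub>M count_space UNIV) \<Longrightarrow>
      Measurable.pred (borel :: (nat \<Rightarrow> nat) measure) (\<lambda>z. P (S z) (T z) (\<alpha> z :: nat \<Rightarrow> nat))"
    and P0: "P S0 T0 \<alpha>0"
  shows "analytic_set (M \<Otimes>\<^sub>M M) {(g S, g T) |S T. \<exists>\<alpha>. P S T \<alpha>}"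
proof -
  \<comment> \<open>The residues modulo 3 separate the three parts; an entry 0 stands for membership
    in a tree.\<close>
  define S where "S z p \<longleftrightarrow> z (3 * to_nat p) = 0" for z :: "nat \<Rightarrow> nat" and p :: "bool list \<times> nat list"
  define T where "T z p \<longleftrightarrow> z (3 * to_nat p + 1) = 0" for z :: "nat \<Rightarrow> nat" and p :: "bool list \<times> nat list"
  define \<alpha> where "\<alpha> z n = z (3 * n + 2)" for z :: "nat \<Rightarrow> nat" and n
  have ev: "(\<lambda>z :: nat \<Rightarrow> nat. z n) \<in> borel \<rightarrow>\<^sub>M count_space UNIV" for n
    unfolding measurable_count_space_eq2_countable
    using measurable_sets[OF measurable_product_then_coordinatewise[of "\<lambda>z. z" borel n] borel_singleton[OF sets.empty_sets]]
    by auto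
  have S: "Measurable.pred borel (\<lambda>z. S z p)" and T: "Measurable.pred borel (\<lambda>z. T z p)"
    and \<alpha>: "(\<lambda>z. \<alpha> z n) \<in> borel \<rightarrow>\<^sub>M count_space UNIV" for p n
    unfolding S_def T_def \<alpha>_def
    by (rule measurable_compose[OF ev measurable_count_space] ev)+
  have S': "S \<in> borel \<rightarrow>\<^sub>M borel" and T': "T \<in> borel \<rightarrow>\<^sub>M borel"
    by (auto intro!: measurable_coordinatewise_then_product measurable_compose[OF _ borel_measurable_count_space] S T)
  have mod3: "(3 * n + 1) mod 3 = 1" "(3 * n + 1) div 3 = n" "(3 * n + 2) mod 3 = 2" "(3 * n + 2) div 3 = n"
    "Suc (3 * n) mod 3 = 1" "Suc (3 * n) div 3 = n" "Suc (Suc (3 * n)) mod 3 = 2" "Suc (Suc (3 * n)) div 3 = n"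
    for n :: nat by presburger+
  have surj: "\<exists>z. S z = A \<and> T z = B \<and> \<alpha> z = a" for A B a
    by (rule exI[of _ "\<lambda>k. if k mod 3 = 0 then (if A (from_nat (k div 3)) then 0 else 1)
       else if k mod 3 = 1 then (if B (from_nat (k div 3)) then 0 else 1) else a (k div 3)"])
       (simp add: S_def T_def \<alpha>_def fun_eq_iff mod3)
  \<comment> \<open>A sequence whose decoding violates \<open>P\<close> is sent to a fixed pair of
    the relation, so the range is exactly the relation.\<close>
  define h where "h z = (if P (S z) (T z) (\<alpha> z) then (g (S z), g (T z)) else (g S0, g T0))" for z
  have "h \<in> borel \<rightarrow>\<^sub>M M \<Otimes>\<^sub>M M"
    unfolding h_def
    by (intro measurable_If measurable_Pair measurable_compose[OF S' g] measurable_compose[OF T' g]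
        measurable_const measurable_space[OF g] P[OF S T \<alpha>, unfolded pred_def]) 
       (use P[OF S T \<alpha>] measurable_space[OF g] in \<open>auto simp: pred_def space_pair_measure\<close>)
  moreover have "range h = {(g S, g T) |S T. \<exists>\<alpha>. P S T \<alpha>}"
  proof (intro equalityI subsetI)
    fix x assume "x \<in> range h"
    then show "x \<in> {(g S, g T) |S T. \<exists>\<alpha>. P S T \<alpha>}" using P0 by (auto simp: h_def)
  next
    fix x assume "x \<in> {(g S, g T) |S T. \<exists>\<alpha>. P S T \<alpha>}"
    then obtain A B a where *: "x = (g A, g B)" "P A B a" by blast
    obtain z where "S z = A" "T z = B" "\<alpha> z = a" using surj by blast
    then have "h z = x" using * by (simp add: h_def)
    then show "x \<in> range h" by blast
  qed
  ultimately show ?thesis unfolding analytic_set_def by blast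
qed

text \<open>Interleaving the two shifts leaves a single existential quantifier over sequences, the
  form in which analyticity is established.\<close>

lemma eq_S_iff_le_via:
  "eq_S S T \<longleftrightarrow> (\<exists>\<gamma>. le_via S T (\<lambda>n. \<gamma> (2 * n)) \<and> le_via T S (\<lambda>n. \<gamma> (2 * n + 1)))"
proof
  assume "eq_S S T"
  then obtain \<alpha> \<beta> where "le_via S T \<alpha>" "le_via T S \<beta>"
    by (auto simp: eq_S_def le_S_iff_le_via)
  then show "\<exists>\<gamma>. le_via S T (\<lambda>n. \<gamma> (2 * n)) \<and> le_via T S (\<lambda>n. \<gamma> (2 * n + 1))"
    by (intro exI[of _ "\<lambda>n. if even n then \<alpha> (n div 2) else \<beta> (n div 2)"]) simp
qed (auto simp: eq_S_def le_S_iff_le_via)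

text \<open>The relations are taken on all sets of pairs, a compact Polish space, and only the map
  \<open>g\<close> is restricted to pruned normal trees.\<close>

lemma tree_relations_on_reals:
  obtains M :: "real measure" and g where "standard_borel M" "inj g" "space M = range g"
    "g \<in> Tpr_space \<rightarrow>\<^sub>M M" "analytic_set (M \<Otimes>\<^sub>M M) {(g S, g T) |S T. le_S S T}"
    "analytic_set (M \<Otimes>\<^sub>M M) {(g S, g T) |S T. eq_S S T}"
proof -
  obtain g :: "tree \<Rightarrow> real" where g: "inj g" using ex_inj_tree_real by blast
  obtain M where M: "standard_borel M" "space M = range g" "g \<in> borel \<rightarrow>\<^sub>M M"
    using standard_borel_copy[OF g Polish_space_tree] by blast
  show thesis
  proof
    show "g \<in> Tpr_space \<rightarrow>\<^sub>M M"
      unfolding Tpr_space_def using M(3) by (rule measurable_restrict_space1)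
    show "analytic_set (M \<Otimes>\<^sub>M M) {(g S, g T) |S T. le_S S T}"
      unfolding le_S_iff_le_via
      by (rule analytic_set_tree_relation[where P = le_via, OF M(3) pred_le_via le_via_refl])
    show "analytic_set (M \<Otimes>\<^sub>M M) {(g S, g T) |S T. eq_S S T}"
      unfolding eq_S_iff_le_via
      by (rule analytic_set_tree_relation[OF M(3),
          where P = "\<lambda>S T \<gamma>. le_via S T (\<lambda>n. \<gamma> (2 * n)) \<and> le_via T S (\<lambda>n. \<gamma> (2 * n + 1))"
            and ?\<alpha>0.0 = "\<lambda>_. 0", OF _ conjI[OF le_via_refl le_via_refl]])
         (intro pred_intros_logic pred_le_via)
  qed (use g M in auto)
qed

section \<open>Assembly of the two completeness statements\<close>

theorem mainTheorem2:
  shows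
   "((\<forall>(M :: 'a measure) R. standard_borel M \<and> analytic_quasiorder M R \<longrightarrow>
        (\<exists>f. borel_hom M (\<lambda>x y. (x, y) \<in> R) (\<lambda>x y. (x, y) \<notin> R) Tpr_space le_S nsub_S f)) \<and>
     (\<exists>(M :: real measure) R g. standard_borel M \<and> analytic_quasiorder M R \<and>
        borel_hom Tpr_space le_S nsub_S M (\<lambda>x y. (x, y) \<in> R) (\<lambda>x y. (x, y) \<notin> R) g))
  \<and>
    ((\<forall>(M :: 'a measure) R. standard_borel M \<and> analytic_equivalence M R \<longrightarrow>
        (\<exists>f. borel_hom M (\<lambda>x y. (x, y) \<in> R) (\<lambda>x y. (x, y) \<notin> R) Tpr_space eq_S neq_S f)) \<and>
     (\<exists>(M :: real measure) R g. standard_borel M \<and> analytic_equivalence M R \<and>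
        borel_hom Tpr_space eq_S neq_S M (\<lambda>x y. (x, y) \<in> R) (\<lambda>x y. (x, y) \<notin> R) g))"
proof (intro conjI allI impI)
  fix M :: "'a measure" and R
  assume "standard_borel M \<and> analytic_quasiorder M R"
  then obtain f where "f \<in> M \<rightarrow>\<^sub>M Tpr_space" "\<And>x y. (x, y) \<in> R \<Longrightarrow> le_S (f x) (f y)"
    "\<And>x y. x \<in> space M \<Longrightarrow> y \<in> space M \<Longrightarrow> (x, y) \<notin> R \<Longrightarrow> nsub_S (f x) (f y)"
    using analytic_quasiorder_hom by blast
  then show "\<exists>f. borel_hom M (\<lambda>x y. (x, y) \<in> R) (\<lambda>x y. (x, y) \<notin> R) Tpr_space le_S nsub_S f"
    unfolding borel_hom_def by blast
next
  fix M :: "'a measure" and R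
  assume *: "standard_borel M \<and> analytic_equivalence M R"
  \<comment> \<open>A symmetric quasiorder turns the one-sided reduction into a mutual one, and a
    failed inclusion of projections is in particular an inequality.\<close>
  then have "sym R" "analytic_quasiorder M R"
    by (auto simp: analytic_equivalence_def analytic_quasiorder_def equiv_def preorder_on_def)
  then obtain f where f: "f \<in> M \<rightarrow>\<^sub>M Tpr_space" "\<And>x y. (x, y) \<in> R \<Longrightarrow> le_S (f x) (f y)"
    "\<And>x y. x \<in> space M \<Longrightarrow> y \<in> space M \<Longrightarrow> (x, y) \<notin> R \<Longrightarrow> nsub_S (f x) (f y)"
    using analytic_quasiorder_hom * by blast
  have "eq_S (f x) (f y)" if "(x, y) \<in> R" for x y
    using that f(2) \<open>sym R\<close> by (auto simp: eq_S_def dest: symD)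
  moreover have "neq_S (f x) (f y)" if "x \<in> space M" "y \<in> space M" "(x, y) \<notin> R" for x y
    using f(3)[OF that] by (auto simp: nsub_S_def neq_S_def)
  ultimately show "\<exists>f. borel_hom M (\<lambda>x y. (x, y) \<in> R) (\<lambda>x y. (x, y) \<notin> R) Tpr_space eq_S neq_S f"
    unfolding borel_hom_def using f(1) by blast
next
  obtain M :: "real measure" and g where M: "standard_borel M" "inj g" "space M = range g"
    "g \<in> Tpr_space \<rightarrow>\<^sub>M M" "analytic_set (M \<Otimes>\<^sub>M M) {(g S, g T) |S T. le_S S T}"
    by (rule tree_relations_on_reals)
  define R where "R = {(g S, g T) |S T. le_S S T}"
  have R: "(g S, g T) \<in> R \<longleftrightarrow> le_S S T" for S T
    using M(2) by (auto simp: R_def inj_eq)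
  have "analytic_quasiorder M R"
    unfolding analytic_quasiorder_def preorder_on_def refl_on_def
  proof (intro conjI ballI)
    show "trans R"
      using M(2) by (auto simp: R_def trans_def inj_eq intro: le_S_trans)
    show "analytic_set (M \<Otimes>\<^sub>M M) R" unfolding R_def by (rule M)
  qed (auto simp: M(3) R le_S_refl, auto simp: R_def)
  \<comment> \<open>A pair in \<open>R\<close> would be related by \<open>le_S\<close>,
    contradicting the failed inclusion.\<close>
  moreover have "borel_hom Tpr_space le_S nsub_S M (\<lambda>x y. (x, y) \<in> R) (\<lambda>x y. (x, y) \<notin> R) g"
    unfolding borel_hom_def R nsub_S_def using M(4) le_S_imp_A_tree_subset by blast
  ultimately show "\<exists>(M :: real measure) R g. standard_borel M \<and> analytic_quasiorder M R \<and>
        borel_hom Tpr_space le_S nsub_S M (\<lambda>x y. (x, y) \<in> R) (\<lambda>x y. (x, y) \<notin> R) g"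
    using M(1) by blast
next
  obtain M :: "real measure" and g where M: "standard_borel M" "inj g" "space M = range g"
    "g \<in> Tpr_space \<rightarrow>\<^sub>M M" "analytic_set (M \<Otimes>\<^sub>M M) {(g S, g T) |S T. eq_S S T}"
    by (rule tree_relations_on_reals)
  define R where "R = {(g S, g T) |S T. eq_S S T}"
  have R: "(g S, g T) \<in> R \<longleftrightarrow> eq_S S T" for S T
    using M(2) by (auto simp: R_def inj_eq)
  have "analytic_equivalence M R"
    unfolding analytic_equivalence_def equiv_def refl_on_def
  proof (intro conjI ballI)
    show "trans R"
      using M(2) by (auto simp: R_def trans_def inj_eq eq_S_def intro: le_S_trans)
    show "sym R"
      by (auto simp: R_def sym_def eq_S_def)
    show "analytic_set (M \<Otimes>\<^sub>M M) R" unfolding R_def by (rule M)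
  qed (auto simp: M(3) R eq_S_def le_S_refl, auto simp: R_def)
  \<comment> \<open>Mutual reducibility forces equal projections, so \<open>neq_S\<close> maps
    outside \<open>R\<close>.\<close>
  moreover have "borel_hom Tpr_space eq_S neq_S M (\<lambda>x y. (x, y) \<in> R) (\<lambda>x y. (x, y) \<notin> R) g"
    unfolding borel_hom_def R neq_S_def eq_S_def using M(4) le_S_imp_A_tree_subset by blast
  ultimately show "\<exists>(M :: real measure) R g. standard_borel M \<and> analytic_equivalence M R \<and>
        borel_hom Tpr_space eq_S neq_S M (\<lambda>x y. (x, y) \<in> R) (\<lambda>x y. (x, y) \<notin> R) g"
    using M(1) by blast
qed

end
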